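(* Let $G=(V,E)$ be a finite connected graph with at least two vertices and maximal degree $\Delta$. Then for every $v \in V$, $$ \left| \left\{u \in V : \frac{1}{\deg(u)} \sum_{w:\,(u, w) \in E} d(w,v) < d(u,v) \right\}\right| \geq \frac{1}{2\Delta}\, \frac{|V|}{\operatorname{diam}(G)}.$$
   Context: Graphs are finite, simple and undirected. $d(\cdot,\cdot)$ is the graph distance (number of edges in a shortest path), $\deg(u)$ is the number of neighbors of $u$, and $\operatorname{diam}(G)=\max_{u,v\in V} d(u,v)$. *)

theory Defs
  imports "Graph_Theory.Graph_Theory"
begin

text \<open>
  Finite simple undirected graphs are represented by the locale predicate \<^const>\<open>graph\<close>:
  finite, loop-free digraphs without multiple arcs whose arc set is symmetric, so that each
  undirected edge corresponds to a pair of opposite arcs. Hence the out-degree of a vertex is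
  the number of its neighbours, as confirmed below.
\<close>

definition neighbors :: "('a, 'b) pre_digraph \<Rightarrow> 'a \<Rightarrow> 'a set" where
  "neighbors G u = {w. u \<rightarrow>\<^bsub>G\<^esub> w}"

lemma out_degree_eq_card_neighbors:
  assumes "graph G"
  shows "out_degree G u = card (neighbors G u)"
proof -
  interpret graph G by fact
  have "neighbors G u = head G ` out_arcs G u"
    by (auto simp: neighbors_def arcs_ends_conv)
  moreover have "inj_on (head G) (out_arcs G u)"
    by (rule inj_onI) (auto intro!: no_multi_arcs simp: arc_to_ends_def)
  ultimately show ?thesis
    by (simp add: out_degree_def card_image)
qed

text \<open>
  The distance is the minimal weight of a walk under unit arc weights. The value at pairs of
  vertices not joined by a walk is the arbitrary 0; it does not occur in a connected graph.
\<close>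

definition graph_dist :: "('a, 'b) pre_digraph \<Rightarrow> 'a \<Rightarrow> 'a \<Rightarrow> real" where
  "graph_dist G u v = real_of_ereal (wf_digraph.\<mu> G (\<lambda>_. 1) u v)"

lemma graph_dist_attained:
  assumes "graph G" and "u \<rightarrow>\<^sup>*\<^bsub>G\<^esub> v"
  shows "\<exists>p. pre_digraph.apath G u p v \<and> graph_dist G u v = real (length p)"
proof -
  interpret graph G by fact
  have unit: "awalk_cost (\<lambda>_. 1) p = real (length p)" for p
    by (induction p) simp_all
  from min_cost_awalk[OF assms(2), of "\<lambda>_. 1"]
  obtain p where "apath u p v" "\<mu> (\<lambda>_. 1) u v = awalk_cost (\<lambda>_. 1) p"
    by auto
  then show ?thesis
    by (auto simp: graph_dist_def unit)
qed

lemma graph_dist_le_length: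
  assumes "graph G" and "pre_digraph.awalk G u p v"
  shows "graph_dist G u v \<le> real (length p)"
proof -
  interpret graph G by fact
  have unit: "awalk_cost (\<lambda>_. 1) p = real (length p)" for p
    by (induction p) simp_all
  have "u \<rightarrow>\<^sup>*\<^bsub>G\<^esub> v"
    using assms(2) by (auto simp: reachable_awalk)
  from min_cost_awalk[OF this, of "\<lambda>_. 1"]
  obtain q where "\<mu> (\<lambda>_. 1) u v = awalk_cost (\<lambda>_. 1) q"
    by auto
  with min_cost_le_walk_cost[OF assms(2), of "\<lambda>_. 1"] show ?thesis
    by (simp add: graph_dist_def unit)
qed

definition graph_diam :: "('a, 'b) pre_digraph \<Rightarrow> real" where
  "graph_diam G = Max {graph_dist G u v | u v. u \<in> verts G \<and> v \<in> verts G}"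

definition max_degree :: "('a, 'b) pre_digraph \<Rightarrow> nat" where
  "max_degree G = Max (out_degree G ` verts G)"

end

theory Submission
  imports Defs
begin

text \<open>
  Put \<open>f u = d(u, v)\<close> and \<open>L u = (\<Sum>w\<sim>u. f u - f w)\<close>. Summation by parts gives
  \<open>2 * (\<Sum>u. f u * L u) = (\<Sum>u. \<Sum>w\<sim>u. (f u - f w)\<^sup>2)\<close>, and the right-hand side is at least
  \<open>2 * (n - 1)\<close> because every vertex other than \<open>v\<close> has a neighbour closer to \<open>v\<close>. Only the vertices with \<open>L u > 0\<close>
  contribute positively to the left-hand side, each at most the diameter times the maximal
  degree; finally \<open>n - 1 \<ge> n / 2\<close>.
\<close>

context graph
begin

lemma neighbors_subset_verts: "neighbors G u \<subseteq> verts G"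
  by (auto simp: neighbors_def)

lemma finite_neighbors [simp]: "finite (neighbors G u)"
  using neighbors_subset_verts finite_verts by (rule finite_subset)

lemma neighbors_sym: "w \<in> neighbors G u \<longleftrightarrow> u \<in> neighbors G w"
  using sym_arcs by (auto simp: neighbors_def symmetric_def sym_def)

text \<open>Adjacency is symmetric, so each edge is counted in both orientations and exchanging the
  roles of its ends only reorders the sum. This is what makes summation by parts work.\<close>

lemma sum_neighbors_swap:
  "(\<Sum>u\<in>verts G. \<Sum>w\<in>neighbors G u. h u w) = (\<Sum>u\<in>verts G. \<Sum>w\<in>neighbors G u. h w u)"
proof -
  \<comment> \<open>The inner index set is recast as a filter of \<open>verts G\<close>, the shape
    that \<open>sum.swap_restrict\<close> exchanges.\<close>
  have N: "neighbors G u = {w \<in> verts G. w \<in> neighbors G u}" for u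
    using neighbors_subset_verts by auto
  show ?thesis
    by (subst (1 2) N, subst sum.swap_restrict) (simp_all add: neighbors_sym)
qed

text \<open>Summation by parts. Positive parts absorb the factor 2: the square of an edge difference
  is kept only in the orientation in which \<open>f\<close> decreases.\<close>

lemma sum_mult_laplacian:
  fixes f :: "'a \<Rightarrow> real"
  shows "(\<Sum>u\<in>verts G. f u * (\<Sum>w\<in>neighbors G u. f u - f w)) =
    (\<Sum>u\<in>verts G. \<Sum>w\<in>neighbors G u. (max 0 (f u - f w))\<^sup>2)"
proof -
  define A where "A = (\<Sum>u\<in>verts G. \<Sum>w\<in>neighbors G u. f u * (f u - f w))"
  define B where "B = (\<Sum>u\<in>verts G. \<Sum>w\<in>neighbors G u. (max 0 (f u - f w))\<^sup>2)"
  have "2 * A = A + (\<Sum>u\<in>verts G. \<Sum>w\<in>neighbors G u. f w * (f w - f u))"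
    unfolding A_def by (subst (2) sum_neighbors_swap) simp
  \<comment> \<open>Pointwise, with a = \<open>f u\<close> and b = \<open>f w\<close>: a(a - b) +
    b(b - a) = (a - b)^2, and at most one of the positive parts of a - b and b - a is
    nonzero.\<close>
  also have "\<dots> = B + (\<Sum>u\<in>verts G. \<Sum>w\<in>neighbors G u. (max 0 (f w - f u))\<^sup>2)"
    unfolding A_def B_def sum.distrib [symmetric]
    by (intro sum.cong refl) (auto simp: max_def power2_eq_square algebra_simps)
  also have "\<dots> = 2 * B"
    unfolding B_def by (subst (2) sum_neighbors_swap) simp
  finally have "A = B"
    by simp
  then show ?thesis
    by (simp add: A_def B_def sum_distrib_left)
qed

lemma graph_dist_nonneg:
  assumes "u \<rightarrow>\<^sup>*\<^bsub>G\<^esub> v"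
  shows "graph_dist G u v \<ge> 0"
  using graph_dist_attained [OF graph_axioms assms] by auto

lemma graph_dist_neighbor_le:
  assumes "w \<in> neighbors G u" "w \<rightarrow>\<^sup>*\<^bsub>G\<^esub> v"
  shows "graph_dist G u v \<le> 1 + graph_dist G w v"
proof -
  obtain p where p: "apath w p v" "graph_dist G w v = real (length p)"
    using graph_dist_attained [OF graph_axioms assms(2)] by blast
  obtain e where "e \<in> arcs G" "tail G e = u" "head G e = w"
    using assms(1) by (auto simp: neighbors_def arcs_ends_conv)
  then have "awalk u (e # p) v"
    using p(1) by (auto simp: awalk_Cons_iff apath_def)
  from graph_dist_le_length [OF graph_axioms this] show ?thesis
    by (simp add: p(2))
qed

text \<open>The second vertex of a shortest path serves as the witness, since the rest of the path
  bounds its distance to \<open>v\<close>.\<close>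

lemma closer_neighbor:
  assumes "u \<rightarrow>\<^sup>*\<^bsub>G\<^esub> v" "u \<noteq> v"
  obtains w where "w \<in> neighbors G u" "graph_dist G w v + 1 \<le> graph_dist G u v"
proof -
  obtain p where p: "apath u p v" "graph_dist G u v = real (length p)"
    using graph_dist_attained [OF graph_axioms assms(1)] by blast
  with assms(2) obtain e q where q: "p = e # q"
    by (cases p) (auto simp: apath_def awalk_Nil_iff)
  with p(1) have e: "e \<in> arcs G" "tail G e = u" "awalk (head G e) q v"
    by (auto simp: awalk_Cons_iff apath_def)
  have "head G e \<in> neighbors G u"
    using e(1,2) by (auto simp: neighbors_def arcs_ends_conv)
  moreover have "graph_dist G (head G e) v + 1 \<le> graph_dist G u v"
    using graph_dist_le_length [OF graph_axioms e(3)] by (simp add: p(2) q)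
  ultimately show ?thesis
    by (rule that)
qed

lemma graph_dist_le_diam:
  assumes "u \<in> verts G" "v \<in> verts G"
  shows "graph_dist G u v \<le> graph_diam G"
proof -
  \<comment> \<open>Exhibiting the set as an image of a finite product gives the finiteness that
    \<open>Max_ge\<close> requires.\<close>
  have "{graph_dist G u v | u v. u \<in> verts G \<and> v \<in> verts G} =
      (\<lambda>(u, v). graph_dist G u v) ` (verts G \<times> verts G)"
    by auto
  then show ?thesis
    unfolding graph_diam_def using assms by (intro Max_ge) auto
qed

lemma out_degree_le_max_degree: "u \<in> verts G \<Longrightarrow> out_degree G u \<le> max_degree G"
  unfolding max_degree_def by (intro Max_ge) auto

text \<open>The core estimate, kept in product form so that no division by the diameter or the
  degree occurs yet.\<close>

lemma card_pos_laplacian_graph_dist: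
  assumes "Digraph_Component.connected G" "v \<in> verts G"
  shows "real (card (verts G)) - 1 \<le> graph_diam G * real (max_degree G) *
    real (card {u \<in> verts G. (\<Sum>w\<in>neighbors G u. graph_dist G u v - graph_dist G w v) > 0})"
proof -
  define f where "f u = graph_dist G u v" for u
  define L where "L u = (\<Sum>w\<in>neighbors G u. f u - f w)" for u
  define S where "S = {u \<in> verts G. L u > 0}"
  \<comment> \<open>Symmetry of the arcs upgrades connectedness to strong connectedness, so no
    distance to \<open>v\<close> takes the default value 0 of unreachable pairs.\<close>
  have reach: "u \<rightarrow>\<^sup>*\<^bsub>G\<^esub> v" if "u \<in> verts G" for u
    using assms that symmetric_connected_imp_strongly_connected [OF sym_arcs]
    by (auto simp: strongly_connected_def)
  have f_nonneg: "f u \<ge> 0" if "u \<in> verts G" for u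
    using reach [OF that] graph_dist_nonneg by (simp add: f_def)
  have closer: "1 \<le> (\<Sum>w\<in>neighbors G u. (max 0 (f u - f w))\<^sup>2)" if "u \<in> verts G - {v}" for u
  proof -
    from that obtain w where w: "w \<in> neighbors G u" "f w + 1 \<le> f u"
      using closer_neighbor [of u v] reach by (auto simp: f_def)
    then have "1 \<le> (max 0 (f u - f w))\<^sup>2"
      by simp
    also have "\<dots> \<le> (\<Sum>w\<in>neighbors G u. (max 0 (f u - f w))\<^sup>2)"
      using w(1) by (intro member_le_sum) auto
    finally show ?thesis .
  qed
  have "real (card (verts G)) - 1 = (\<Sum>u\<in>verts G - {v}. 1)"
    using assms(2) card.remove [of "verts G" v] by simp
  also have "\<dots> \<le> (\<Sum>u\<in>verts G - {v}. \<Sum>w\<in>neighbors G u. (max 0 (f u - f w))\<^sup>2)"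
    using closer by (rule sum_mono)
  also have "\<dots> \<le> (\<Sum>u\<in>verts G. \<Sum>w\<in>neighbors G u. (max 0 (f u - f w))\<^sup>2)"
    by (intro sum_mono2) (auto intro: sum_nonneg)
  also have "\<dots> = (\<Sum>u\<in>verts G. f u * L u)"
    by (simp add: sum_mult_laplacian L_def)
  \<comment> \<open>Since \<open>f\<close> is nonnegative, the discarded terms are at most
    0.\<close>
  also have "\<dots> \<le> (\<Sum>u\<in>verts G. if L u > 0 then f u * L u else 0)"
    using f_nonneg by (intro sum_mono) (auto simp: not_less mult_nonneg_nonpos)
  also have "\<dots> = (\<Sum>u\<in>S. f u * L u)"
    by (simp add: S_def sum.inter_filter)
  also have "\<dots> \<le> (\<Sum>u\<in>S. graph_diam G * real (max_degree G))"
  proof (rule sum_mono)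
    fix u assume "u \<in> S"
    then have u: "u \<in> verts G" "L u > 0"
      by (auto simp: S_def)
    have "L u \<le> (\<Sum>w\<in>neighbors G u. 1)"
      unfolding L_def
    proof (rule sum_mono)
      fix w assume w: "w \<in> neighbors G u"
      then have "w \<rightarrow>\<^sup>*\<^bsub>G\<^esub> v"
        using neighbors_subset_verts reach by blast
      with w show "f u - f w \<le> 1"
        using graph_dist_neighbor_le [of w u v] by (simp add: f_def)
    qed
    also have "\<dots> \<le> real (max_degree G)"
      using out_degree_le_max_degree [OF u(1)]
      by (simp add: out_degree_eq_card_neighbors [OF graph_axioms])
    finally have "L u \<le> real (max_degree G)" .
    moreover have "f u \<le> graph_diam G"
      using graph_dist_le_diam u(1) assms(2) by (simp add: f_def)
    ultimately show "f u * L u \<le> graph_diam G * real (max_degree G)"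
      using u f_nonneg [OF u(1)] by (intro mult_mono) auto
  qed
  finally show ?thesis
    by (simp add: S_def L_def f_def mult_ac)
qed

end

theorem theorem2:
  fixes G :: "('a, 'b) pre_digraph" and v :: 'a
  assumes "graph G"
    and "Digraph_Component.connected G"
    and "card (verts G) \<ge> 2"
    and "v \<in> verts G"
  shows "real (card {u \<in> verts G.
           1 / real (out_degree G u) * (\<Sum>w\<in>neighbors G u. graph_dist G w v) < graph_dist G u v})
         \<ge> 1 / (2 * real (max_degree G)) * (real (card (verts G)) / graph_diam G)"
proof -
  interpret graph G by fact
  define T where "T = {u \<in> verts G.
    1 / real (out_degree G u) * (\<Sum>w\<in>neighbors G u. graph_dist G w v) < graph_dist G u v}"
  define S where "S = {u \<in> verts G.
    (\<Sum>w\<in>neighbors G u. graph_dist G u v - graph_dist G w v) > 0}"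
  have "S \<subseteq> T"
  proof
    fix u assume u: "u \<in> S"
    \<comment> \<open>A positive sum cannot be empty, so the degree is nonzero and dividing by it
      turns the condition of \<open>S\<close> into that of \<open>T\<close>.\<close>
    then have "neighbors G u \<noteq> {}"
      by (auto simp: S_def)
    then have "out_degree G u > 0"
      by (simp add: out_degree_eq_card_neighbors [OF graph_axioms] card_gt_0_iff)
    with u show "u \<in> T"
      by (simp add: S_def T_def sum_subtractf field_simps
          out_degree_eq_card_neighbors [OF graph_axioms, symmetric])
  qed
  then have card_le: "card S \<le> card T"
    by (intro card_mono) (auto simp: T_def)
  have diam: "graph_diam G \<ge> 0"
    using graph_dist_nonneg [of v v] graph_dist_le_diam [of v v] assms(4) by auto
  \<comment> \<open>Having at least two vertices gives n \<le> 2(n - 1), the source of the factor 2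
    in the bound.\<close>
  have "real (card (verts G)) \<le> 2 * (real (card (verts G)) - 1)"
    using assms(3) by simp
  also have "\<dots> \<le> 2 * (graph_diam G * real (max_degree G) * real (card S))"
    using card_pos_laplacian_graph_dist [OF assms(2,4)] by (simp add: S_def)
  also have "\<dots> \<le> 2 * (graph_diam G * real (max_degree G) * real (card T))"
    using card_le diam by (intro mult_left_mono) auto
  finally have main:
    "real (card (verts G)) \<le> 2 * (graph_diam G * real (max_degree G) * real (card T))" .
  have "1 / (2 * real (max_degree G)) * (real (card (verts G)) / graph_diam G) \<le> real (card T)"
  \<comment> \<open>If either factor vanishes, division by zero makes the left-hand side 0.\<close>
  proof (cases "graph_diam G = 0 \<or> max_degree G = 0")
    case False
    with main diam show ?thesis
      by (simp add: field_simps)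
  qed auto
  then show ?thesis
    by (simp add: T_def)
qed

end
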